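(* For all integers $n,p\ge 0$, \[ \mathrm{Bel}_{n,\lambda}^{(p)}(x)=\sum_{k=0}^{n}\frac{S_{2,\lambda}(n,k)}{\binom{k+p}{k}}\,x^{k}. \]
   Context: Let $\lambda\in\mathbb{R}$. Set $(x)_{0,\lambda}=1$ and $(x)_{n,\lambda}=x(x-\lambda)\cdots(x-(n-1)\lambda)$ for $n\ge1$; also $(x)_0=1$, $(x)_n=x(x-1)\cdots(x-n+1)$. The degenerate exponential is the formal power series $e_\lambda^x(t)=\sum_{n\ge0}(x)_{n,\lambda}\frac{t^n}{n!}$ (equal to $(1+\lambda t)^{x/\lambda}$, and to $e^{xt}$ when $\lambda=0$), and $e_\lambda(t)=e_\lambda^1(t)$. The degenerate Stirling numbers of the second kind $S_{2,\lambda}(n,k)$ are defined by $(x)_{n,\lambda}=\sum_{k=0}^n S_{2,\lambda}(n,k)(x)_k$; equivalently $\frac{1}{k!}(e_\lambda(t)-1)^k=\sum_{n\ge k}S_{2,\lambda}(n,k)\frac{t^n}{n!}$. For an integer $p\ge0$, the truncated degenerate Bell polynomials $\mathrm{Bel}^{(p)}_{n,\lambda}(x)$ are defined by \[\sum_{n\ge0}\mathrm{Bel}^{(p)}_{n,\lambda}(x)\frac{t^n}{n!}=\frac{p!}{x^p(e_\lambda(t)-1)^p}\Big(e^{x(e_\lambda(t)-1)}-\sum_{k=0}^{p-1}\frac{x^k(e_\lambda(t)-1)^k}{k!}\Big),\] i.e. as formal power series the right-hand side is $p!\sum_{k\ge0}\frac{x^k(e_\lambda(t)-1)^k}{(k+p)!}$.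 *)

theory Defs
  imports Complex_Main "HOL-Computational_Algebra.Computational_Algebra"
begin

unbundle fps_syntax

text \<open>
  \<open>deg_ffact \<lambda> x n\<close> is \<open>x (x - \<lambda>) \<dots> (x - (n - 1) \<lambda>)\<close>. The ordinary falling factorial
  is the case \<open>\<lambda> = 1\<close>.
\<close>

definition deg_ffact :: "real \<Rightarrow> real \<Rightarrow> nat \<Rightarrow> real" where
  "deg_ffact lam x n = (\<Prod>i<n. x - real i * lam)"

abbreviation ffact :: "real \<Rightarrow> nat \<Rightarrow> real" where
  "ffact \<equiv> deg_ffact 1"

definition deg_exp :: "real \<Rightarrow> real \<Rightarrow> real fps" where
  "deg_exp lam x = Abs_fps (\<lambda>n. deg_ffact lam x n / fact n)"

text \<open>
  Row \<open>n\<close> of the degenerate Stirling numbers of the second kind consists of the coordinates of the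
  degenerate falling factorial of order \<open>n\<close> in the basis of ordinary falling factorials, extended
  by zero. Existence and uniqueness are shown in \<open>deg_Stirling2_ex1\<close> below.
\<close>

definition deg_Stirling2 :: "real \<Rightarrow> nat \<Rightarrow> nat \<Rightarrow> real" where
  "deg_Stirling2 lam n =
     (THE c. (\<forall>x. deg_ffact lam x n = (\<Sum>k\<le>n. c k * ffact x k)) \<and> (\<forall>k>n. c k = 0))"

text \<open>
  The variable \<open>x\<close> of the Bell polynomials is an indeterminate, so their generating function is a
  power series in \<open>t\<close> over \<open>real poly\<close>, and \<open>monom c k\<close> stands for \<open>c x\<^sup>k\<close>.
  \<open>deg_exp_m1\<close> is the series \<open>e\<^sub>\<lambda>(t) - 1\<close> with its coefficients regarded as constant polynomials,
  and \<open>exp_x\<close> is \<open>exp (x u)\<close> as a power series in \<open>u\<close>.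
\<close>

definition deg_exp_m1 :: "real \<Rightarrow> real poly fps" where
  "deg_exp_m1 lam = Abs_fps (\<lambda>n. [:(deg_exp lam 1 - 1) $ n:])"

definition exp_x :: "real poly fps" where
  "exp_x = Abs_fps (\<lambda>k. monom (1 / fact k) k)"

text \<open>
  With \<open>u = e\<^sub>\<lambda>(t) - 1\<close>, this is \<open>p! / (x\<^sup>p u\<^sup>p) (exp (x u) - (\<Sum>k<p. x\<^sup>k u\<^sup>k / k!))\<close>.
  The denominator is in general not a unit of \<open>real poly fps\<close>, but it divides the numerator in this integral
  domain (lemma \<open>trunc_deg_Bell_gf_ex1\<close>); the definition takes that quotient.
\<close>

definition trunc_deg_Bell_gf :: "real \<Rightarrow> nat \<Rightarrow> real poly fps" where
  "trunc_deg_Bell_gf lam p =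
     (THE G. fps_const (monom 1 p) * deg_exp_m1 lam ^ p * G =
             fact p * ((exp_x oo deg_exp_m1 lam) -
               (\<Sum>k<p. fps_const (monom (1 / fact k) k) * deg_exp_m1 lam ^ k)))"

definition trunc_deg_Bell :: "real \<Rightarrow> nat \<Rightarrow> nat \<Rightarrow> real poly" where
  "trunc_deg_Bell lam p n = smult (fact n) (trunc_deg_Bell_gf lam p $ n)"


lemma deg_ffact_Suc: "deg_ffact lam x (Suc n) = deg_ffact lam x n * (x - real n * lam)"
  by (simp add: deg_ffact_def)

lemma ffact_eq_0: "m < k \<Longrightarrow> ffact (real m) k = 0"
  by (auto simp: deg_ffact_def)

lemma ffact_self_neq_0: "ffact (real m) m \<noteq> 0"
  by (auto simp: deg_ffact_def)

lemma ffact_combination_eq_0: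
  assumes "\<And>x. (\<Sum>k\<le>n. c k * ffact x k) = 0" and "m \<le> n"
  shows "c m = 0"
  using assms(2)
proof (induction m rule: less_induct)
  case (less m)
  have "c k * ffact (real m) k = (if k = m then c m * ffact (real m) m else 0)" if "k \<le> n" for k
    using less.IH[of k] that by (cases k m rule: linorder_cases) (auto simp: ffact_eq_0)
  hence "(\<Sum>k\<le>n. c k * ffact (real m) k) = (\<Sum>k\<le>n. if k = m then c m * ffact (real m) m else 0)"
    by (intro sum.cong) auto
  also have "\<dots> = c m * ffact (real m) m"
    using less.prems by simp
  finally show ?case
    using assms(1)[of "real m"] ffact_self_neq_0[of m] by simp
qed

lemma deg_Stirling2_exists:
  "\<exists>c. (\<forall>x. deg_ffact lam x n = (\<Sum>k\<le>n. c k * ffact x k)) \<and> (\<forall>k>n. c k = 0)"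
proof (induction n)
  case 0
  show ?case
    by (rule exI[of _ "\<lambda>k. if k = 0 then 1 else 0"]) (simp add: deg_ffact_def)
next
  case (Suc n)
  then obtain c where c: "\<And>x. deg_ffact lam x n = (\<Sum>k\<le>n. c k * ffact x k)"
      and c0: "\<And>k. k > n \<Longrightarrow> c k = 0"
    by auto
  define d where "d k = (if k = 0 then 0 else c (k - 1)) + (real k - real n * lam) * c k" for k
  have "deg_ffact lam x (Suc n) = (\<Sum>k\<le>Suc n. d k * ffact x k)" for x
  proof -
    have "deg_ffact lam x (Suc n) = (\<Sum>k\<le>n. c k * ffact x k * (x - real n * lam))"
      by (simp add: deg_ffact_Suc c sum_distrib_right)
    also have "\<dots> = (\<Sum>k\<le>n. c k * ffact x (Suc k))
        + (\<Sum>k\<le>n. (real k - real n * lam) * c k * ffact x k)"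
      unfolding sum.distrib[symmetric]
      by (intro sum.cong) (auto simp: deg_ffact_Suc algebra_simps)
    also have "(\<Sum>k\<le>n. c k * ffact x (Suc k))
        = (\<Sum>k\<le>Suc n. (if k = 0 then 0 else c (k - 1)) * ffact x k)"
      by (subst sum.atMost_Suc_shift) simp
    also have "(\<Sum>k\<le>n. (real k - real n * lam) * c k * ffact x k)
        = (\<Sum>k\<le>Suc n. (real k - real n * lam) * c k * ffact x k)"
      by (simp add: c0)
    finally show ?thesis
      by (simp only: d_def distrib_right sum.distrib)
  qed
  moreover have "d k = 0" if "k > Suc n" for k
    using that c0[of k] c0[of "k - 1"] by (simp add: d_def)
  ultimately show ?case
    by blast
qed

lemma deg_Stirling2_ex1:
  "\<exists>!c. (\<forall>x. deg_ffact lam x n = (\<Sum>k\<le>n. c k * ffact x k)) \<and> (\<forall>k>n. c k = 0)"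
proof (rule ex_ex1I[OF deg_Stirling2_exists])
  fix c d
  assume c: "(\<forall>x. deg_ffact lam x n = (\<Sum>k\<le>n. c k * ffact x k)) \<and> (\<forall>k>n. c k = 0)"
    and d: "(\<forall>x. deg_ffact lam x n = (\<Sum>k\<le>n. d k * ffact x k)) \<and> (\<forall>k>n. d k = 0)"
  have "(\<Sum>k\<le>n. (c k - d k) * ffact x k) = 0" for x
    using c d by (simp add: left_diff_distrib sum_subtractf)
  from ffact_combination_eq_0[OF this] have "c k = d k" if "k \<le> n" for k
    using that by fastforce
  thus "c = d"
    using c d by (metis ext not_le)
qed

lemma deg_exp_m1_nth_0: "deg_exp_m1 lam $ 0 = 0"
  by (simp add: deg_exp_m1_def deg_exp_def deg_ffact_def)

lemma deg_exp_m1_neq_0: "deg_exp_m1 lam \<noteq> 0"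
proof -
  have "deg_exp_m1 lam $ 1 = [:1:]"
    by (simp add: deg_exp_m1_def deg_exp_def deg_ffact_def)
  thus ?thesis by auto
qed

text \<open>
  The quotient exists and equals \<open>p! \<Sum>k. x\<^sup>k (e\<^sub>\<lambda>(t) - 1)\<^sup>k / (k + p)!\<close>.
\<close>

lemma trunc_deg_Bell_gf_solution:
  fixes lam :: real and p :: nat
  defines "U \<equiv> deg_exp_m1 lam"
  shows "fps_const (monom 1 p) * U ^ p * (Abs_fps (\<lambda>k. monom (fact p / fact (k + p)) k) oo U) =
           fact p * ((exp_x oo U) - (\<Sum>k<p. fps_const (monom (1 / fact k) k) * U ^ k))"
proof -
  let ?H = "Abs_fps (\<lambda>k. monom (fact p / fact (k + p)) k) :: real poly fps"
  have U0: "U $ 0 = 0"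
    by (simp add: U_def deg_exp_m1_nth_0)
  have pow: "fps_X ^ k oo U = U ^ k" for k
    using U0 by (simp flip: fps_compose_power)
  have factp: "fact p = fps_const [:fact p:]"
    by (metis fps_of_nat of_nat_fact of_nat_poly)
  have trunc: "(\<Sum>k<p. fps_const (monom (1 / fact k) k) * fps_X ^ k) =
      (Abs_fps (\<lambda>n. if n < p then monom (1 / fact n) n else 0) :: real poly fps)"
    by (rule fps_ext) (simp add: fps_sum_nth if_distrib[of "\<lambda>x. _ * x"] cong: if_cong)
  have eq: "fps_const (monom 1 p) * fps_X ^ p * ?H =
      fact p * (exp_x - (\<Sum>k<p. fps_const (monom (1 / fact k) k) * fps_X ^ k))"
    unfolding trunc factp
    by (rule fps_ext)
       (auto simp: exp_x_def mult.assoc fps_X_power_mult_nth mult_monom smult_monom)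
  have "(fps_const (monom 1 p) * fps_X ^ p * ?H) oo U = fps_const (monom 1 p) * U ^ p * (?H oo U)"
    by (simp add: fps_compose_mult_distrib[OF U0] pow)
  moreover have "(fact p * (exp_x - (\<Sum>k<p. fps_const (monom (1 / fact k) k) * fps_X ^ k))) oo U =
      fact p * ((exp_x oo U) - (\<Sum>k<p. fps_const (monom (1 / fact k) k) * U ^ k))"
    unfolding factp
    by (simp add: fps_compose_mult_distrib[OF U0] fps_compose_sub_distrib fps_compose_sum_distrib pow)
  ultimately show ?thesis
    using eq by simp
qed

lemma trunc_deg_Bell_gf_ex1:
  "\<exists>!G. fps_const (monom 1 p) * deg_exp_m1 lam ^ p * G =
          fact p * ((exp_x oo deg_exp_m1 lam) -
            (\<Sum>k<p. fps_const (monom (1 / fact k) k) * deg_exp_m1 lam ^ k))"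
proof (rule ex_ex1I)
  have nz: "fps_const (monom (1 :: real) p) * deg_exp_m1 lam ^ p \<noteq> 0"
    by (simp add: deg_exp_m1_neq_0 monom_eq_0_iff)
  show "G = G'"
    if "fps_const (monom 1 p) * deg_exp_m1 lam ^ p * G =
          fact p * ((exp_x oo deg_exp_m1 lam) -
            (\<Sum>k<p. fps_const (monom (1 / fact k) k) * deg_exp_m1 lam ^ k))"
      and "fps_const (monom 1 p) * deg_exp_m1 lam ^ p * G' =
          fact p * ((exp_x oo deg_exp_m1 lam) -
            (\<Sum>k<p. fps_const (monom (1 / fact k) k) * deg_exp_m1 lam ^ k))"
    for G G'
    using that nz by (metis mult_left_cancel)
qed (use trunc_deg_Bell_gf_solution in blast)

lemma trunc_deg_Bell_gf_series:
  "trunc_deg_Bell_gf lam p =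
     Abs_fps (\<lambda>k. monom (fact p / fact (k + p)) k) oo deg_exp_m1 lam"
  unfolding trunc_deg_Bell_gf_def
  by (rule the1_equality[OF trunc_deg_Bell_gf_ex1 trunc_deg_Bell_gf_solution])

end

(*
  Put V = e_lambda(t) - 1. Since (1 + lambda t) e_lambda' = e_lambda, the series V^k / k! satisfy
  (1 + lambda t) (V^(k+1) / (k+1)!)' = V^k / k! + (k+1) V^(k+1) / (k+1)!. On coefficients this is
  the recurrence of the degenerate Stirling numbers, so n! [t^n] V^k / k! = S(n, k). The theorem
  then follows by reading off the coefficient of t^n in p! (Sum k. x^k V^k / (k + p)!).
*)
theory Submission
  imports Defs
begin

lemma deg_ffact_eq_sum_deg_Stirling2:
  "deg_ffact lam x n = (\<Sum>k\<le>n. deg_Stirling2 lam n k * ffact x k)"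
  and deg_Stirling2_eq_0: "k > n \<Longrightarrow> deg_Stirling2 lam n k = 0"
  using theI'[OF deg_Stirling2_ex1[of lam n]] unfolding deg_Stirling2_def by blast+

lemma deg_Stirling2_eqI:
  assumes "\<And>x. deg_ffact lam x n = (\<Sum>k\<le>n. c k * ffact x k)" and "\<And>k. k > n \<Longrightarrow> c k = 0"
  shows "deg_Stirling2 lam n = c"
  unfolding deg_Stirling2_def by (rule the1_equality[OF deg_Stirling2_ex1]) (use assms in auto)

lemma deg_Stirling2_0_left: "deg_Stirling2 lam 0 = (\<lambda>k. if k = 0 then 1 else 0)"
  by (rule deg_Stirling2_eqI) (auto simp: deg_ffact_def)

text \<open>Multiply row \<open>n\<close> by \<open>x - n lam = (x - k) + (k - n lam)\<close>: the
  first part raises \<open>ffact x k\<close> to \<open>ffact x (Suc k)\<close>, the second only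
  rescales it. Uniqueness of coordinates does the rest.\<close>

lemma deg_Stirling2_Suc_left:
  "deg_Stirling2 lam (Suc n) =
     (\<lambda>k. (if k = 0 then 0 else deg_Stirling2 lam n (k - 1)) +
          (real k - real n * lam) * deg_Stirling2 lam n k)"
proof (rule deg_Stirling2_eqI)
  let ?S = "deg_Stirling2 lam n"
  fix x
  have "deg_ffact lam x (Suc n) = (\<Sum>k\<le>n. ?S k * ffact x k * (x - real n * lam))"
    by (simp add: deg_ffact_Suc deg_ffact_eq_sum_deg_Stirling2[of lam x n] sum_distrib_right)
  also have "\<dots> = (\<Sum>k\<le>n. ?S k * ffact x (Suc k)) +
      (\<Sum>k\<le>n. (real k - real n * lam) * ?S k * ffact x k)"
    unfolding sum.distrib[symmetric]
    by (intro sum.cong) (auto simp: deg_ffact_Suc algebra_simps)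
  also have "(\<Sum>k\<le>n. ?S k * ffact x (Suc k)) =
      (\<Sum>k\<le>Suc n. (if k = 0 then 0 else ?S (k - 1)) * ffact x k)"
    by (subst sum.atMost_Suc_shift) simp
  \<comment> \<open>The added term at \<open>Suc n\<close> vanishes since row \<open>n\<close> is
    zero beyond \<open>n\<close>.\<close>
  also have "(\<Sum>k\<le>n. (real k - real n * lam) * ?S k * ffact x k) =
      (\<Sum>k\<le>Suc n. (real k - real n * lam) * ?S k * ffact x k)"
    by (simp add: deg_Stirling2_eq_0)
  finally show "deg_ffact lam x (Suc n) =
      (\<Sum>k\<le>Suc n. ((if k = 0 then 0 else ?S (k - 1)) + (real k - real n * lam) * ?S k) * ffact x k)"
    by (simp only: distrib_right sum.distrib)
qed (auto simp: deg_Stirling2_eq_0)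

text \<open>Coefficientwise this is \<open>deg_ffact_Suc\<close>; no closed form is used, so
  \<open>lam = 0\<close> needs no separate treatment.\<close>

lemma fps_deriv_deg_exp:
  "(1 + fps_const lam * fps_X) * fps_deriv (deg_exp lam x) = fps_const x * deg_exp lam x"
proof (rule fps_ext)
  fix n
  have rec: "real (Suc n) * deg_exp lam x $ Suc n = (x - real n * lam) * deg_exp lam x $ n" for n
    by (simp add: deg_exp_def deg_ffact_Suc del: of_nat_Suc)
  have "((1 + fps_const lam * fps_X) * fps_deriv (deg_exp lam x)) $ n =
      real (Suc n) * deg_exp lam x $ Suc n + lam * (real n * deg_exp lam x $ n)"
    by (cases n) (simp_all add: distrib_right mult.assoc)
  thus "((1 + fps_const lam * fps_X) * fps_deriv (deg_exp lam x)) $ n =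
      (fps_const x * deg_exp lam x) $ n"
    unfolding rec by (simp add: algebra_simps)
qed

text \<open>Chain rule together with \<open>(1 + lam t) V' = 1 + V\<close>. At \<open>k = 0\<close>
  the truncated \<open>k - 1\<close> is harmless because of the factor
  \<open>of_nat k\<close>.\<close>

lemma fps_deriv_deg_exp_m1_power:
  fixes lam :: real
  defines "V \<equiv> deg_exp lam 1 - 1"
  shows "(1 + fps_const lam * fps_X) * fps_deriv (V ^ k) =
           of_nat k * (V ^ (k - 1) + V ^ k)"
proof (cases k)
  case (Suc j)
  have "(1 + fps_const lam * fps_X) * fps_deriv V = 1 + V"
    using fps_deriv_deg_exp[of lam 1] by (simp add: V_def)
  moreover have "fps_deriv (V ^ k) = of_nat k * fps_deriv V * V ^ j"
    by (simp only: fps_deriv_power' Suc diff_Suc_1)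
  ultimately have "(1 + fps_const lam * fps_X) * fps_deriv (V ^ k) = of_nat k * (1 + V) * V ^ j"
    by (metis mult.assoc mult.left_commute)
  thus ?thesis
    by (simp add: Suc algebra_simps del: of_nat_Suc)
qed simp

text \<open>The exponent \<open>k\<close> stays arbitrary because the step uses coefficient
  \<open>n\<close> of both \<open>V ^ (k - 1)\<close> and \<open>V ^ k\<close>.\<close>

lemma deg_exp_m1_power_nth:
  "((deg_exp lam 1 - 1) ^ k) $ n = fact k / fact n * deg_Stirling2 lam n k"
proof (induction n arbitrary: k)
  case 0
  have "(deg_exp lam 1 - 1) $ 0 = 0"
    by (simp add: deg_exp_def deg_ffact_def)
  thus ?case
    by (simp add: deg_Stirling2_0_left fps_power_zeroth)
next
  case (Suc n)
  define V where "V = deg_exp lam 1 - 1"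
  have "((1 + fps_const lam * fps_X) * fps_deriv (V ^ k)) $ n =
      real (Suc n) * (V ^ k) $ Suc n + lam * real n * (V ^ k) $ n"
    by (cases n) (simp_all add: distrib_right mult.assoc)
  also have "(1 + fps_const lam * fps_X) * fps_deriv (V ^ k) = of_nat k * (V ^ (k - 1) + V ^ k)"
    unfolding V_def by (rule fps_deriv_deg_exp_m1_power)
  also have "\<dots> $ n = real k * ((V ^ (k - 1)) $ n + (V ^ k) $ n)"
    by (simp flip: fps_of_nat)
  finally have "real (Suc n) * (V ^ k) $ Suc n =
      real k * (V ^ (k - 1)) $ n + (real k - real n * lam) * (V ^ k) $ n"
    by (simp add: algebra_simps)
  \<comment> \<open>For \<open>k > 0\<close>, \<open>k * fact (k - 1) = fact k\<close> gives both
    terms the same prefactor; for \<open>k = 0\<close> the first term is absent on both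
    sides.\<close>
  also have "\<dots> = fact k / fact n * deg_Stirling2 lam (Suc n) k"
    unfolding V_def Suc.IH
    by (cases k) (simp_all add: deg_Stirling2_Suc_left field_simps)
  finally show ?case
    by (simp add: V_def field_simps del: of_nat_Suc)
qed

text \<open>Embedding reals as constant polynomials respects sums and products, hence Cauchy
  products, so the powers can be computed over the reals.\<close>

lemma deg_exp_m1_power_conv:
  "(deg_exp_m1 lam ^ k) $ n = [:((deg_exp lam 1 - 1) ^ k) $ n:]"
proof (induction k arbitrary: n)
  case (Suc k)
  have const_sum: "(\<Sum>i\<in>A. [:f i:]) = [:\<Sum>i\<in>A. f i:]" for A :: "nat set" and f :: "nat \<Rightarrow> real"
    by (induction A rule: infinite_finite_induct) auto
  have "(deg_exp_m1 lam ^ Suc k) $ n =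
      (\<Sum>i=0..n. [:(deg_exp lam 1 - 1) $ i * ((deg_exp lam 1 - 1) ^ k) $ (n - i):])"
    by (simp add: fps_mult_nth Suc.IH) (simp add: deg_exp_m1_def mult.commute)
  thus ?case
    by (simp add: const_sum fps_mult_nth)
qed (auto simp: one_pCons)

theorem theorem1:
  fixes lam :: real and n p :: nat
  shows "trunc_deg_Bell lam p n =
           (\<Sum>k\<le>n. monom (deg_Stirling2 lam n k / real ((k + p) choose k)) k)"
proof -
  have "trunc_deg_Bell lam p n =
      (\<Sum>k\<le>n. smult (fact n) (monom (fact p / fact (k + p)) k * (deg_exp_m1 lam ^ k) $ n))"
    using sum_distrib_left[of "[:fact n:]"
        "\<lambda>k. monom (fact p / fact (k + p)) k * (deg_exp_m1 lam ^ k) $ n" "{..n}"]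
    by (simp add: trunc_deg_Bell_def trunc_deg_Bell_gf_series fps_compose_nth atLeast0AtMost)
  \<comment> \<open>The factor \<open>n!\<close> cancels, leaving \<open>p! k! / (k + p)!\<close>,
    the reciprocal of the binomial coefficient.\<close>
  also have "\<dots> = (\<Sum>k\<le>n. monom (deg_Stirling2 lam n k / real ((k + p) choose k)) k)"
    by (intro sum.cong)
       (simp_all add: deg_exp_m1_power_conv deg_exp_m1_power_nth smult_monom binomial_fact)
  finally show ?thesis .
qed

end
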